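(* There exists a sequence of pairs of max-plus automata $(\mathcal{A}_n,\mathcal{B}_n)_{n\ge1}$ (for each $n$, over a common finite alphabet and with $\mathcal{A}_n$ deterministic) such that for all $n\ge1$: (1) there exists a tractable witness (of non-domination) in $\mathfrak{M}_{\mathcal{A}_n,\mathcal{B}_n}$ of $\sharp\flat$-height $n$; (2) there is no witness (of non-domination) in $\mathfrak{M}_{\mathcal{A}_n,\mathcal{B}_n}$ of $\sharp\flat$-height strictly less than $n$.
   Context: **Automata.** $\mathbb{N}_{\max}=\mathbb{N}\cup\{-\infty\}$ with $\max$ and $+$. A max-plus automaton is $\langle Q,\Sigma,M,I,F\rangle$ with $Q$, $\Sigma$ finite, $M:\Sigma\to\mathbb{N}_{\max}^{Q\times Q}$, $I\in\mathbb{N}_{\max}^{1\times Q}$, $F\in\mathbb{N}_{\max}^{Q\times 1}$. It is deterministic if $I$ has at most one entry $\ne-\infty$ and each row of each $M(a)$ has at most one entry $\neq-\infty$. A state $p$ is initial if $I_p\neq-\infty$, final if $F_p\ne-\infty$; all states are assumed accessible and co-accessible. Write $p\xrightarrow{a:x}q$ if $M(a)_{p,q}=x\ne-\infty$. Below, $\mathcal{A}$ is a deterministic max-plus automaton and $\mathcal{B}$ a max-plus automaton over the same alphabet $\Sigma$, with data indexed by $\mathcal{A}$, $\mathcal{B}$. **Semirings.** $\Omega=\{-\infty,0,1,\infty\}$ with $\max$ for the order $-\infty<0<1<\infty$ and commutative sum: $-\infty+x=-\infty$ for all $x$, $0+x=x$, $1+1=1$, $1+\infty=\infty+\infty=\infty$.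 The bar map sends $-\infty\mapsto-\infty$, $0\mapsto0$, and every positive integer and $\infty$ to $1$; it is applied entrywise to matrices. Matrix products over $\Omega$ are written $\otimes$. **Semigroups.** Elements are tuples $(p,x,q,M)$ with $p,q\in Q_{\mathcal{A}}$, $x\in\Omega$, $M\in\Omega^{Q_{\mathcal{B}}\times Q_{\mathcal{B}}}$, together with an absorbing element $\bot$; the product is $(p,x,q,M)\otimes(p',x',q',M')=(p,x+x',q',M\otimes M')$ if $q=p'$, and $\bot$ otherwise. A matrix $M$ is path-idempotent if $\overline{M}\otimes\overline{M}=\overline{M}$; $(p,x,q,M)$ is path-idempotent if $p=q$ and $M$ is path-idempotent. Stabilisation: on $\Omega$, $(-\infty)^\sharp=-\infty$, $0^\sharp=0$, $1^\sharp=\infty^\sharp=\infty$. For $M$ path-idempotent, $M^\sharp=M\otimes M'\otimes M$, where $M'$ is $M$ with each diagonal entry replaced by its stabilisation; $(p,x,p,M)^\sharp=(p,x^\sharp,p,M^\sharp)$. Flattening: for $M$ path-idempotent, $M^\flat=\overline{M}\otimes\langle M^3\rangle\otimes\overline{M}$, where $\langle N\rangle$ is $N$ with all non-diagonal entries replaced by their barred versions; $(p,x,p,M)^\flat=(p,x,p,M^\flat)$. Let $X_{\mathcal{A},\mathcal{B}}=\{(p,\overline{x},q,\overline{M_{\mathcal{B}}(a)})\mid a\in\Sigma,\ p\xrightarrow{a:x}q\text{ in }\mathcal{A}\}$. $\overline{\mathfrak{M}}_{\mathcal{A},\mathcal{B}}$ is the subsemigroup generated by $X_{\mathcal{A},\mathcal{B}}$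 under product. $\mathfrak{M}_{\mathcal{A},\mathcal{B}}$ is the smallest subset containing $X_{\mathcal{A},\mathcal{B}}$ closed under product and under stabilisation and flattening of its path-idempotent elements. **Witnesses.** $(p,x,q,M)\in\mathfrak{M}_{\mathcal{A},\mathcal{B}}$ is a witness of non-domination if $p$ is initial in $\mathcal{A}$, $q$ is final in $\mathcal{A}$, $x=\infty$, and $\overline{I_{\mathcal{B}}}\otimes M\otimes\overline{F_{\mathcal{B}}}<\infty$. It is a tractable witness of non-domination if moreover it is of the form $$g_0(g_1(\cdots(g_{k-2}(g_{k-1}(g_k)^\sharp g'_{k-1})^\flat g'_{k-2})^\flat\cdots)^\flat g_1')^\flat g_0'$$ (one $\sharp$, innermost, and $k-1$ nested $\flat$; every $\sharp$ and $\flat$ applied to a path-idempotent element), with $k\le 3|\overline{\mathfrak{M}}_{\mathcal{A},\mathcal{B}}|$ and all $g_i,g_i'\in\overline{\mathfrak{M}}_{\mathcal{A},\mathcal{B}}\cup\{\mathsf{id}\}$, where $\mathsf{id}$ is an added identity element. **$\sharp\flat$-height.** $\sharp\flat$-expressions over $X_{\mathcal{A},\mathcal{B}}$ are the formal expressions built inductively from elements of $X_{\mathcal{A},\mathcal{B}}$ by $s,t\mapsto st$, $s\mapsto s^\sharp$, $s\mapsto s^\flat$. The evaluation $\pi$ maps them to $\mathfrak{M}_{\mathcal{A},\mathcal{B}}\cup\{\bot\}$: $\pi(x)=x$, $\pi(st)=\pi(s)\otimes\pi(t)$, $\pi(s^\sharp)=\pi(s)^\sharp$ and $\pi(s^\flat)=\pi(s)^\flat$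 if $\pi(s)$ is path-idempotent and $\bot$ otherwise. The $\sharp\flat$-height of an expression is $0$ for $x\in X_{\mathcal{A},\mathcal{B}}$, the maximum of the heights of $s,t$ for $st$, and $1$ plus the height of $s$ for $s^\sharp$ and $s^\flat$. The $\sharp\flat$-height of $z\in\mathfrak{M}_{\mathcal{A},\mathcal{B}}$ is the minimum of the $\sharp\flat$-heights of expressions $s$ with $\pi(s)=z$. *)

theory Defs
  imports Main
begin

section \<open>Max-plus automata\<close>

text \<open>The set of weights \<open>\<nat> \<union> {-\<infinity>}\<close>. Only the entries of the weight matrices matter below (not
  their max-plus products), so no operations are introduced on it.\<close>

datatype nmax = NegInf | Fin nat

text \<open>Matrices indexed by finite state sets are functions on the whole index type that are \<open>-\<infinity>\<close>
  outside the state set; with this convention equality of functions is equality of matrices.\<close>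

record ('q, 'a) mpa =
  states :: "'q set"
  alphabet :: "'a set"
  wt :: "'a \<Rightarrow> 'q \<Rightarrow> 'q \<Rightarrow> nmax"
  init :: "'q \<Rightarrow> nmax"
  final :: "'q \<Rightarrow> nmax"

definition edges :: "('q, 'a) mpa \<Rightarrow> ('q \<times> 'q) set" where
  "edges A = {(p, q). \<exists>a \<in> alphabet A. wt A a p q \<noteq> NegInf}"

definition accessible :: "('q, 'a) mpa \<Rightarrow> 'q \<Rightarrow> bool" where
  "accessible A q \<longleftrightarrow> (\<exists>p. init A p \<noteq> NegInf \<and> (p, q) \<in> (edges A)\<^sup>*)"

definition coaccessible :: "('q, 'a) mpa \<Rightarrow> 'q \<Rightarrow> bool" where
  "coaccessible A p \<longleftrightarrow> (\<exists>q. final A q \<noteq> NegInf \<and> (p, q) \<in> (edges A)\<^sup>*)"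

definition mp_automaton :: "('q, 'a) mpa \<Rightarrow> bool" where
  "mp_automaton A \<longleftrightarrow>
     finite (states A) \<and> finite (alphabet A) \<and>
     (\<forall>a \<in> alphabet A. \<forall>p q. wt A a p q \<noteq> NegInf \<longrightarrow> p \<in> states A \<and> q \<in> states A) \<and>
     (\<forall>p. init A p \<noteq> NegInf \<longrightarrow> p \<in> states A) \<and>
     (\<forall>p. final A p \<noteq> NegInf \<longrightarrow> p \<in> states A) \<and>
     (\<forall>p \<in> states A. accessible A p \<and> coaccessible A p)"

definition deterministic :: "('q, 'a) mpa \<Rightarrow> bool" where
  "deterministic A \<longleftrightarrow>
     (\<exists>\<^sub>\<le>\<^sub>1 p. init A p \<noteq> NegInf) \<and>
     (\<forall>a \<in> alphabet A. \<forall>p. \<exists>\<^sub>\<le>\<^sub>1 q. wt A a p q \<noteq> NegInf)"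


section \<open>The semiring \<open>\<Omega>\<close> and its matrices\<close>

datatype omega = OmNegInf | Om0 | Om1 | OmInf

instantiation omega :: linorder
begin

primrec rank_omega :: "omega \<Rightarrow> nat" where
  "rank_omega OmNegInf = 0"
| "rank_omega Om0 = 1"
| "rank_omega Om1 = 2"
| "rank_omega OmInf = 3"

definition less_eq_omega :: "omega \<Rightarrow> omega \<Rightarrow> bool" where
  "x \<le> y \<longleftrightarrow> rank_omega x \<le> rank_omega y"

definition less_omega :: "omega \<Rightarrow> omega \<Rightarrow> bool" where
  "x < y \<longleftrightarrow> rank_omega x < rank_omega y"

instance
proof
  fix x y :: omega
  assume "x \<le> y" "y \<le> x"
  then show "x = y"
    by (cases x; cases y) (simp_all add: less_eq_omega_def)
qed (auto simp: less_eq_omega_def less_omega_def)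

end

instantiation omega :: comm_monoid_add
begin

definition zero_omega :: omega where
  "0 = Om0"

fun plus_omega :: "omega \<Rightarrow> omega \<Rightarrow> omega" where
  "OmNegInf + y = OmNegInf"
| "x + OmNegInf = OmNegInf"
| "Om0 + y = y"
| "x + Om0 = x"
| "Om1 + Om1 = Om1"
| "OmInf + y = OmInf"
| "x + OmInf = OmInf"

instance
proof
  fix x y z :: omega
  show "x + y + z = x + (y + z)" by (cases x; cases y; cases z) simp_all
  show "x + y = y + x" by (cases x; cases y) simp_all
  show "0 + x = x" by (cases x) (simp_all add: zero_omega_def)
qed

end

fun bar_nmax :: "nmax \<Rightarrow> omega" where
  "bar_nmax NegInf = OmNegInf"
| "bar_nmax (Fin n) = (if n = 0 then Om0 else Om1)"

fun bar :: "omega \<Rightarrow> omega" where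
  "bar OmNegInf = OmNegInf"
| "bar Om0 = Om0"
| "bar Om1 = Om1"
| "bar OmInf = Om1"

fun stab :: "omega \<Rightarrow> omega" where
  "stab OmNegInf = OmNegInf"
| "stab Om0 = Om0"
| "stab Om1 = OmInf"
| "stab OmInf = OmInf"

text \<open>Matrix product with inner index set \<open>Q\<close>; the inserted \<open>-\<infinity>\<close> is the maximum of the empty set.\<close>

definition mprod :: "'k set \<Rightarrow> ('i \<Rightarrow> 'k \<Rightarrow> omega) \<Rightarrow> ('k \<Rightarrow> 'j \<Rightarrow> omega) \<Rightarrow> 'i \<Rightarrow> 'j \<Rightarrow> omega" where
  "mprod Q M N = (\<lambda>i j. Max (insert OmNegInf ((\<lambda>k. M i k + N k j) ` Q)))"

type_synonym 'q omat = "'q \<Rightarrow> 'q \<Rightarrow> omega"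

definition mbar :: "'q omat \<Rightarrow> 'q omat" where
  "mbar M = (\<lambda>p q. bar (M p q))"

definition mpath_idem :: "'q set \<Rightarrow> 'q omat \<Rightarrow> bool" where
  "mpath_idem Q M \<longleftrightarrow> mprod Q (mbar M) (mbar M) = mbar M"

definition mstab :: "'q set \<Rightarrow> 'q omat \<Rightarrow> 'q omat" where
  "mstab Q M = mprod Q (mprod Q M (\<lambda>p q. if p = q then stab (M p q) else M p q)) M"

definition bar_offdiag :: "'q omat \<Rightarrow> 'q omat" where
  "bar_offdiag N = (\<lambda>p q. if p = q then N p q else bar (N p q))"

definition mflat :: "'q set \<Rightarrow> 'q omat \<Rightarrow> 'q omat" where
  "mflat Q M = mprod Q (mprod Q (mbar M) (bar_offdiag (mprod Q (mprod Q M M) M))) (mbar M)"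


section \<open>The stabilisation-flattening semigroups\<close>

datatype ('p, 'q) elem = Bot | Elem 'p omega 'p "'q \<Rightarrow> 'q \<Rightarrow> omega"

text \<open>In the following operations \<open>Q\<close> is the set of states indexing the matrices.\<close>

fun eprod :: "'q set \<Rightarrow> ('p, 'q) elem \<Rightarrow> ('p, 'q) elem \<Rightarrow> ('p, 'q) elem" where
  "eprod Q (Elem p x q M) (Elem p' x' q' M') =
     (if q = p' then Elem p (x + x') q' (mprod Q M M') else Bot)"
| "eprod Q Bot z = Bot"
| "eprod Q z Bot = Bot"

fun path_idem :: "'q set \<Rightarrow> ('p, 'q) elem \<Rightarrow> bool" where
  "path_idem Q Bot = False"
| "path_idem Q (Elem p x q M) = (p = q \<and> mpath_idem Q M)"

text \<open>Stabilisation and flattening are only meaningful, and only used, on path-idempotent elements.\<close>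

fun estab :: "'q set \<Rightarrow> ('p, 'q) elem \<Rightarrow> ('p, 'q) elem" where
  "estab Q Bot = Bot"
| "estab Q (Elem p x q M) = Elem p (stab x) q (mstab Q M)"

fun eflat :: "'q set \<Rightarrow> ('p, 'q) elem \<Rightarrow> ('p, 'q) elem" where
  "eflat Q Bot = Bot"
| "eflat Q (Elem p x q M) = Elem p x q (mflat Q M)"

definition gens :: "('p, 'a) mpa \<Rightarrow> ('q, 'a) mpa \<Rightarrow> ('p, 'q) elem set" where
  "gens A B = {Elem p (bar_nmax (wt A a p q)) q (\<lambda>r s. bar_nmax (wt B a r s)) | a p q.
                 a \<in> alphabet A \<and> wt A a p q \<noteq> NegInf}"

inductive_set bar_semigroup :: "('p, 'a) mpa \<Rightarrow> ('q, 'a) mpa \<Rightarrow> ('p, 'q) elem set"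
  for A :: "('p, 'a) mpa" and B :: "('q, 'a) mpa" where
  gen: "z \<in> gens A B \<Longrightarrow> z \<in> bar_semigroup A B"
| prod: "y \<in> bar_semigroup A B \<Longrightarrow> z \<in> bar_semigroup A B
    \<Longrightarrow> eprod (states B) y z \<in> bar_semigroup A B"

inductive_set sf_semigroup :: "('p, 'a) mpa \<Rightarrow> ('q, 'a) mpa \<Rightarrow> ('p, 'q) elem set"
  for A :: "('p, 'a) mpa" and B :: "('q, 'a) mpa" where
  gen: "z \<in> gens A B \<Longrightarrow> z \<in> sf_semigroup A B"
| prod: "y \<in> sf_semigroup A B \<Longrightarrow> z \<in> sf_semigroup A B
    \<Longrightarrow> eprod (states B) y z \<in> sf_semigroup A B"
| stab: "z \<in> sf_semigroup A B \<Longrightarrow> path_idem (states B) z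
    \<Longrightarrow> estab (states B) z \<in> sf_semigroup A B"
| flat: "z \<in> sf_semigroup A B \<Longrightarrow> path_idem (states B) z
    \<Longrightarrow> eflat (states B) z \<in> sf_semigroup A B"


section \<open>Witnesses\<close>

text \<open>The vectors \<open>I\<close> and \<open>F\<close> enter the product as \<open>1 \<times> Q\<close> and \<open>Q \<times> 1\<close> matrices, the index set of
  size one being the type \<open>unit\<close>.\<close>

definition witness :: "('p, 'a) mpa \<Rightarrow> ('q, 'a) mpa \<Rightarrow> ('p, 'q) elem \<Rightarrow> bool" where
  "witness A B z \<longleftrightarrow> z \<in> sf_semigroup A B \<and>
     (\<exists>p x q M. z = Elem p x q M \<and> init A p \<noteq> NegInf \<and> final A q \<noteq> NegInf \<and> x = OmInf \<and>
        mprod (states B) (mprod (states B) (\<lambda>u::unit. \<lambda>r. bar_nmax (init B r)) M)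
          (\<lambda>r. \<lambda>u::unit. bar_nmax (final B r)) () () < OmInf)"

text \<open>Product after adjoining an identity element, represented by \<open>None\<close>.\<close>

fun eprod1 :: "'q set \<Rightarrow> ('p, 'q) elem option \<Rightarrow> ('p, 'q) elem option \<Rightarrow> ('p, 'q) elem option" where
  "eprod1 Q None z = z"
| "eprod1 Q z None = z"
| "eprod1 Q (Some y) (Some z) = Some (eprod Q y z)"

definition bar_monoid :: "('p, 'a) mpa \<Rightarrow> ('q, 'a) mpa \<Rightarrow> ('p, 'q) elem option set" where
  "bar_monoid A B = insert None (Some ` bar_semigroup A B)"

text \<open>\<open>nested A B k z\<close>: the element \<open>z\<close> is a value of
  \<open>(g\<^sub>1 (\<dots> (g\<^sub>k\<^sub>-\<^sub>1 (g\<^sub>k)\<^sup>\<sharp> g'\<^sub>k\<^sub>-\<^sub>1)\<^sup>\<flat> \<dots>)\<^sup>\<flat> g'\<^sub>1)\<^sup>\<flat>\<close>, with one \<open>\<sharp>\<close> and \<open>k - 1\<close> \<open>\<flat>\<close>, each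
  of them applied to a path-idempotent element (in particular \<open>g\<^sub>k\<close> is not the adjoined identity).\<close>

inductive nested :: "('p, 'a) mpa \<Rightarrow> ('q, 'a) mpa \<Rightarrow> nat \<Rightarrow> ('p, 'q) elem \<Rightarrow> bool"
  for A :: "('p, 'a) mpa" and B :: "('q, 'a) mpa" where
  innermost: "Some g \<in> bar_monoid A B \<Longrightarrow> path_idem (states B) g
    \<Longrightarrow> nested A B 1 (estab (states B) g)"
| step: "nested A B k z \<Longrightarrow> g \<in> bar_monoid A B \<Longrightarrow> g' \<in> bar_monoid A B
    \<Longrightarrow> eprod1 (states B) (eprod1 (states B) g (Some z)) g' = Some y
    \<Longrightarrow> path_idem (states B) y
    \<Longrightarrow> nested A B (Suc k) (eflat (states B) y)"

definition tractable_witness :: "('p, 'a) mpa \<Rightarrow> ('q, 'a) mpa \<Rightarrow> ('p, 'q) elem \<Rightarrow> bool" where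
  "tractable_witness A B z \<longleftrightarrow> witness A B z \<and>
     (\<exists>k y. \<exists>g \<in> bar_monoid A B. \<exists>g' \<in> bar_monoid A B.
        k \<le> 3 * card (bar_semigroup A B) \<and> nested A B k y \<and>
        Some z = eprod1 (states B) (eprod1 (states B) g (Some y)) g')"


section \<open>Height\<close>

datatype 'x sf_expr =
    Leaf 'x
  | Prod "'x sf_expr" "'x sf_expr"
  | Sharp "'x sf_expr"
  | Flat "'x sf_expr"

primrec sf_eval :: "'q set \<Rightarrow> ('p, 'q) elem sf_expr \<Rightarrow> ('p, 'q) elem" where
  "sf_eval Q (Leaf x) = x"
| "sf_eval Q (Prod s t) = eprod Q (sf_eval Q s) (sf_eval Q t)"
| "sf_eval Q (Sharp s) =
     (if path_idem Q (sf_eval Q s) then estab Q (sf_eval Q s) else Bot)"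
| "sf_eval Q (Flat s) =
     (if path_idem Q (sf_eval Q s) then eflat Q (sf_eval Q s) else Bot)"

primrec expr_height :: "'x sf_expr \<Rightarrow> nat" where
  "expr_height (Leaf x) = 0"
| "expr_height (Prod s t) = max (expr_height s) (expr_height t)"
| "expr_height (Sharp s) = Suc (expr_height s)"
| "expr_height (Flat s) = Suc (expr_height s)"

definition sf_height :: "('p, 'a) mpa \<Rightarrow> ('q, 'a) mpa \<Rightarrow> ('p, 'q) elem \<Rightarrow> nat" where
  "sf_height A B z =
     (LEAST h. \<exists>s. set_sf_expr s \<subseteq> gens A B \<and> sf_eval (states B) s = z \<and> expr_height s = h)"

end

theory Submission
  imports Defs
begin

text \<open>
  The automaton \<open>A\<^sub>n\<close> has one state and counts the letter \<open>0\<close> among the letters \<open>0, \<dots>, n - 1\<close>. The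
  automaton \<open>B\<^sub>n\<close> is a disjoint union of gadgets \<open>k < n\<close>; between two consecutive occurrences of
  letters larger than \<open>k\<close>, gadget \<open>k\<close> chooses one block of letters without \<open>k\<close> and counts the
  letters \<open>0\<close> in it. On the words \<open>((\<dots>(0\<^sup>N 1)\<^sup>N \<dots>)\<^sup>N (n - 1))\<^sup>N\<close> the first automaton has value \<open>N\<^sup>n\<close>
  and the second one has value of order \<open>N\<^sup>n\<^sup>-\<^sup>1\<close>. In the semigroup, \<open>0\<^sup>\<sharp>\<close> produces \<open>\<infinity>\<close> in
  every gadget \<open>k > 0\<close>, and the only way to get rid of it is to remove it from the gadgets one at a
  time, in increasing order, by \<open>z \<mapsto> (z \<otimes> k)\<^sup>\<flat>\<close>: a flattening that also involves a letter
  \<open>k + 1\<close> while gadget \<open>k\<close> is infinite makes \<open>\<infinity>\<close> appear on the diagonal entry of the state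
  \<open>Wait\<close>, where nothing can remove it.
\<close>

section \<open>Matrices over \<open>\<Omega>\<close>\<close>

lemma UNIV_omega: "UNIV = {OmNegInf, Om0, Om1, OmInf}"
  using omega.exhaust by blast

instance omega :: finite
  by standard (simp add: UNIV_omega)

lemma omega_bot [simp]: "OmNegInf \<le> x"
  by (cases x) (simp_all add: less_eq_omega_def)

lemma omega_top [simp]: "x \<le> OmInf"
  by (cases x) (simp_all add: less_eq_omega_def)

lemma OmInf_le_iff [simp]: "OmInf \<le> x \<longleftrightarrow> x = OmInf"
  by (cases x) (simp_all add: less_eq_omega_def)

lemma omega_plus_NegInf [simp]: "x + OmNegInf = OmNegInf"
  by (cases x) simp_all

lemma omega_plus_mono: "x \<le> x' \<Longrightarrow> y \<le> y' \<Longrightarrow> x + y \<le> x' + (y' :: omega)"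
  by (cases x; cases x'; cases y; cases y') (simp_all add: less_eq_omega_def)

lemma omega_plus_eq_OmInf: "x + y = OmInf \<Longrightarrow> x = OmInf \<or> y = OmInf"
  by (cases x; cases y) simp_all

lemma bar_mono: "x \<le> y \<Longrightarrow> bar x \<le> bar y"
  by (cases x; cases y) (simp_all add: less_eq_omega_def)

lemma le_stab: "x \<le> stab x"
  by (cases x) (simp_all add: less_eq_omega_def)

lemma mprod_le_iff:
  assumes "finite Q"
  shows "mprod Q M N i j \<le> v \<longleftrightarrow> (\<forall>k \<in> Q. M i k + N k j \<le> v)"
  using assms by (simp add: mprod_def)

lemma mprod_ge:
  assumes "finite Q" "k \<in> Q" "x \<le> M i k" "y \<le> N k j"
  shows "x + y \<le> mprod Q M N i j"
proof -
  have "M i k + N k j \<le> mprod Q M N i j"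
    using mprod_le_iff[OF assms(1), of M N i j "mprod Q M N i j"] assms(2) by simp
  then show ?thesis
    using omega_plus_mono[OF assms(3,4)] by order
qed

lemma mprod_less_OmInf:
  assumes "finite Q" "\<And>k. k \<in> Q \<Longrightarrow> M i k < OmInf" "\<And>k. k \<in> Q \<Longrightarrow> N k j < OmInf"
  shows "mprod Q M N i j < OmInf"
proof -
  have "M i k + N k j < OmInf" if "k \<in> Q" for k
    using assms(2,3)[OF that] omega_plus_eq_OmInf[of "M i k" "N k j"]
    by (metis OmInf_le_iff not_le)
  moreover have "OmNegInf < OmInf"
    by (simp add: less_omega_def)
  ultimately show ?thesis
    using assms(1) by (simp add: mprod_def)
qed


section \<open>Block diagonal matrices with blocks of size three\<close>

text \<open>Phases of a gadget: before the block in which it counts, inside that block, and after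
  it. Only letters larger than the index of the gadget lead out of \<open>Done\<close>.\<close>

datatype kind = Wait | Count | Done

lemma UNIV_kind: "UNIV = {Wait, Count, Done}"
  using kind.exhaust by blast

instance kind :: finite
  by standard (simp add: UNIV_kind)

definition kind_of :: "nat \<Rightarrow> kind" where
  "kind_of p = (if p mod 3 = 0 then Wait else if p mod 3 = 1 then Count else Done)"

primrec kind_index :: "kind \<Rightarrow> nat" where
  "kind_index Wait = 0"
| "kind_index Count = 1"
| "kind_index Done = 2"

definition state :: "nat \<Rightarrow> kind \<Rightarrow> nat" where
  "state k i = 3 * k + kind_index i"

lemma state_div [simp]: "state k i div 3 = k"
  by (cases i) (simp_all add: state_def)

lemma kind_of_state [simp]: "kind_of (state k i) = i"
  by (cases i) (simp_all add: state_def kind_of_def, presburger)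

lemma state_less_iff [simp]: "state k i < 3 * n \<longleftrightarrow> k < n"
  by (cases i) (auto simp: state_def)

lemma state_div_kind_of: "state (p div 3) (kind_of p) = p"
  by (auto simp: state_def kind_of_def) presburger+

lemma state_cases: obtains k i where "p = state k i"
  using state_div_kind_of by metis

lemma state_inject [simp]: "state k i = state l j \<longleftrightarrow> k = l \<and> i = j"
  by (metis kind_of_state state_div)

text \<open>The family \<open>m\<close> is indexed by all naturals, but only its members below
  \<open>n\<close> are visible in the matrix; invariants on \<open>m\<close> can thus be stated for
  every \<open>k\<close>.\<close>

definition blk :: "nat \<Rightarrow> (nat \<Rightarrow> kind omat) \<Rightarrow> nat omat" where
  "blk n m p q =
     (if p div 3 = q div 3 \<and> p div 3 < n then m (p div 3) (kind_of p) (kind_of q) else OmNegInf)"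

lemma blk_state [simp]:
  "blk n m (state k i) (state l j) = (if k = l \<and> k < n then m k i j else OmNegInf)"
  by (simp add: blk_def)

lemma omat_eqI:
  assumes "\<And>k i l j. M (state k i) (state l j) = N (state k i) (state l j)"
  shows "M = N"
proof (intro ext)
  fix p q
  show "M p q = N p q"
    by (rule state_cases[of p], rule state_cases[of q]) (simp add: assms)
qed

lemma blk_cong: "(\<And>k. k < n \<Longrightarrow> m k = m' k) \<Longrightarrow> blk n m = blk n m'"
  by (rule omat_eqI) simp

lemma blk_eqD: "blk n m = blk n m' \<Longrightarrow> k < n \<Longrightarrow> m k = m' k"
proof (intro ext)
  fix i j
  assume "blk n m = blk n m'" "k < n"
  then have "blk n m (state k i) (state k j) = blk n m' (state k i) (state k j)" by simp
  with \<open>k < n\<close> show "m k i j = m' k i j" by simp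
qed

text \<open>Both entries have the same upper bounds: an inner index outside the common block
  contributes only \<open>OmNegInf\<close>.\<close>

lemma mprod_blk: "mprod {..<3 * n} (blk n m) (blk n m') = blk n (\<lambda>k. mprod UNIV (m k) (m' k))"
proof (rule omat_eqI)
  fix k i l j
  let ?x = "mprod {..<3 * n} (blk n m) (blk n m') (state k i) (state l j)"
  let ?y = "blk n (\<lambda>k. mprod UNIV (m k) (m' k)) (state k i) (state l j)"
  have "?x \<le> v \<longleftrightarrow> ?y \<le> v" for v
  proof -
    have "?x \<le> v \<longleftrightarrow> (\<forall>r < 3 * n. blk n m (state k i) r + blk n m' r (state l j) \<le> v)"
      by (simp add: mprod_le_iff Ball_def)
    also have "\<dots> \<longleftrightarrow> (\<forall>b < n. \<forall>t. blk n m (state k i) (state b t) + blk n m' (state b t) (state l j) \<le> v)"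
      by (metis state_cases state_less_iff)
    also have "\<dots> \<longleftrightarrow> ?y \<le> v"
      by (auto simp: mprod_le_iff)
    finally show ?thesis .
  qed
  then show "?x = ?y"
    by (meson order_antisym order_refl)
qed

lemma mbar_blk: "mbar (blk n m) = blk n (\<lambda>k. mbar (m k))"
  by (rule omat_eqI) (simp add: mbar_def)

lemma bar_offdiag_blk: "bar_offdiag (blk n m) = blk n (\<lambda>k. bar_offdiag (m k))"
  by (rule omat_eqI) (auto simp: bar_offdiag_def)

lemma mstab_blk: "mstab {..<3 * n} (blk n m) = blk n (\<lambda>k. mstab UNIV (m k))"
proof -
  have "(\<lambda>p q. if p = q then stab (blk n m p q) else blk n m p q) =
        blk n (\<lambda>k p q. if p = q then stab (m k p q) else m k p q)"
    by (rule omat_eqI) auto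
  then show ?thesis
    by (simp add: mstab_def mprod_blk)
qed

lemma mflat_blk: "mflat {..<3 * n} (blk n m) = blk n (\<lambda>k. mflat UNIV (m k))"
  by (simp add: mflat_def mprod_blk mbar_blk bar_offdiag_blk)

lemma mpath_idem_blk: "mpath_idem {..<3 * n} (blk n m) \<longleftrightarrow> (\<forall>k < n. mpath_idem UNIV (m k))"
  unfolding mpath_idem_def mprod_blk mbar_blk by (auto dest: blk_eqD intro: blk_cong)

text \<open>Serves to make the bar semigroup finite: \<open>card\<close> is 0 on infinite sets, so a
  lower bound on it requires finiteness.\<close>

lemma finite_blk: "finite (range (blk n))"
proof -
  let ?row = "{f. \<forall>q. (q \<in> {..<3 * n} \<longrightarrow> f q \<in> UNIV) \<and>
                      (q \<notin> {..<3 * n} \<longrightarrow> f q = OmNegInf)}"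
  have row: "finite ?row"
    by (rule finite_set_of_finite_funs) simp_all
  have "blk n m p \<in> ?row" for m p
    by (auto simp: blk_def)
  moreover have "blk n m p = (\<lambda>q. OmNegInf)" if "\<not> p < 3 * n" for m p
    using that by (auto simp: blk_def fun_eq_iff)
  ultimately have "range (blk n) \<subseteq> {f. \<forall>p. (p \<in> {..<3 * n} \<longrightarrow> f p \<in> ?row) \<and>
                      (p \<notin> {..<3 * n} \<longrightarrow> f p = (\<lambda>q. OmNegInf))}"
    by auto
  then show ?thesis
    by (rule finite_subset) (intro finite_set_of_finite_funs row finite_lessThan)
qed


section \<open>The automata\<close>

text \<open>Weight \<open>1\<close> everywhere for the letters larger than \<open>k\<close> makes the products occurring in the
  witness path-idempotent.\<close>

definition gadget_wt :: "nat \<Rightarrow> nat \<Rightarrow> kind \<Rightarrow> kind \<Rightarrow> nmax" where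
  "gadget_wt j k r s =
     (if k < j then Fin 1
      else if r = s \<and> r \<noteq> Count then Fin 0
      else if r \<noteq> Done \<and> s = (if j = k then Done else Count) then Fin (if j = 0 then 1 else 0)
      else NegInf)"

definition aut_A :: "nat \<Rightarrow> (nat, nat) mpa" where
  "aut_A n = \<lparr>states = {0}, alphabet = {..<n},
     wt = (\<lambda>j p q. if p = 0 \<and> q = 0 then Fin (if j = 0 then 1 else 0) else NegInf),
     init = (\<lambda>p. if p = 0 then Fin 0 else NegInf),
     final = (\<lambda>p. if p = 0 then Fin 0 else NegInf)\<rparr>"

definition aut_B :: "nat \<Rightarrow> (nat, nat) mpa" where
  "aut_B n = \<lparr>states = {..<3 * n}, alphabet = {..<n},
     wt = (\<lambda>j p q. if p div 3 = q div 3 \<and> p div 3 < n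
                   then gadget_wt j (p div 3) (kind_of p) (kind_of q) else NegInf),
     init = (\<lambda>p. if p < 3 * n then Fin 0 else NegInf),
     final = (\<lambda>p. if p < 3 * n then Fin 0 else NegInf)\<rparr>"

lemma aut_A_simps [simp]:
  "states (aut_A n) = {0}" "alphabet (aut_A n) = {..<n}"
  "init (aut_A n) p \<noteq> NegInf \<longleftrightarrow> p = 0" "final (aut_A n) p \<noteq> NegInf \<longleftrightarrow> p = 0"
  "wt (aut_A n) j p q \<noteq> NegInf \<longleftrightarrow> p = 0 \<and> q = 0"
  by (simp_all add: aut_A_def)

lemma aut_B_simps [simp]:
  "states (aut_B n) = {..<3 * n}" "alphabet (aut_B n) = {..<n}"
  "init (aut_B n) p \<noteq> NegInf \<longleftrightarrow> p < 3 * n" "final (aut_B n) p \<noteq> NegInf \<longleftrightarrow> p < 3 * n"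
  by (simp_all add: aut_B_def)

lemma mp_automaton_aut_A: "mp_automaton (aut_A n)"
  by (auto simp: mp_automaton_def accessible_def coaccessible_def)

lemma deterministic_aut_A: "deterministic (aut_A n)"
  by (auto simp: deterministic_def Uniq_def)

text \<open>Every state is both initial and final, so empty paths give accessibility and
  co-accessibility.\<close>

lemma mp_automaton_aut_B: "mp_automaton (aut_B n)"
  by (auto simp: mp_automaton_def accessible_def coaccessible_def) (auto simp: aut_B_def split: if_splits)

definition gadget :: "nat \<Rightarrow> nat \<Rightarrow> kind omat" where
  "gadget j k r s = bar_nmax (gadget_wt j k r s)"

definition letter :: "nat \<Rightarrow> nat \<Rightarrow> (nat, nat) elem" where
  "letter n j = Elem 0 (if j = 0 then Om1 else Om0) 0 (blk n (gadget j))"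

lemma gens_aut: "gens (aut_A n) (aut_B n) = letter n ` {..<n}"
proof -
  have "(\<lambda>r s. bar_nmax (wt (aut_B n) j r s)) = blk n (gadget j)" for j
    by (rule omat_eqI) (simp add: aut_B_def gadget_def)
  moreover have "bar_nmax (wt (aut_A n) j 0 0) = (if j = 0 then Om1 else Om0)" for j
    by (simp add: aut_A_def)
  ultimately show ?thesis
    by (auto simp: gens_def letter_def)
qed

lemma inj_on_letter: "inj_on (letter n) {..<n}"
proof (rule inj_onI)
  fix i j
  assume "i \<in> {..<n}" "letter n i = letter n j"
  then have "gadget i i = gadget j i"
    by (auto simp: letter_def dest: blk_eqD)
  \<comment> \<open>Only the letter \<open>i\<close> has the value \<open>OmNegInf\<close> at this
    entry of gadget \<open>i\<close>.\<close>
  then have "gadget i i Count Count = gadget j i Count Count"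
    by simp
  then show "i = j"
    by (simp add: gadget_def gadget_wt_def split: if_splits)
qed

lemma bar_semigroup_form:
  assumes "z \<in> bar_semigroup (aut_A n) (aut_B n)"
  shows "\<exists>x m. z = Elem 0 x 0 (blk n m)"
  using assms
proof induction
  case (gen z)
  then show ?case
    by (auto simp: gens_aut letter_def)
next
  case (prod y z)
  then show ?case
    by (auto simp: mprod_blk)
qed

text \<open>The \<open>n\<close> letters are distinct elements, which is enough to allow nesting
  depth \<open>n\<close> in a tractable witness.\<close>

lemma card_bar_semigroup: "n \<le> card (bar_semigroup (aut_A n) (aut_B n))"
proof -
  have "finite ((\<lambda>(x, M). Elem 0 x 0 M) ` (UNIV \<times> range (blk n)))"
    by (intro finite_imageI finite_cartesian_product finite_blk finite)
  then have "finite (bar_semigroup (aut_A n) (aut_B n))"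
    by (rule rev_finite_subset) (auto dest!: bar_semigroup_form)
  moreover have "letter n ` {..<n} \<subseteq> bar_semigroup (aut_A n) (aut_B n)"
    by (auto simp: gens_aut intro: bar_semigroup.gen)
  ultimately have "card (letter n ` {..<n}) \<le> card (bar_semigroup (aut_A n) (aut_B n))"
    by (rule card_mono)
  then show ?thesis
    by (simp add: card_image inj_on_letter)
qed


section \<open>A witness of height \<open>n\<close>\<close>

text \<open>Gadget \<open>k\<close> on a letter smaller than \<open>k\<close>;
  \<open>exiting\<close> is its shape on the letter \<open>k\<close> itself and
  \<open>saturated\<close> on larger letters. The value \<open>OmInf\<close> for \<open>v\<close>
  arises after stabilisation.\<close>

fun counting :: "omega \<Rightarrow> kind omat" where
  "counting v Wait Wait = Om0"
| "counting v Done Done = Om0"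
| "counting v Wait Count = v"
| "counting v Count Count = v"
| "counting v _ _ = OmNegInf"

fun exiting :: "omega \<Rightarrow> kind omat" where
  "exiting v Wait Wait = Om0"
| "exiting v Done Done = Om0"
| "exiting v Wait Done = v"
| "exiting v Count Done = v"
| "exiting v _ _ = OmNegInf"

definition saturated :: "kind omat" where
  "saturated = (\<lambda>_ _. Om1)"

lemma kind_omat_eqI:
  assumes "M Wait Wait = N Wait Wait" "M Wait Count = N Wait Count" "M Wait Done = N Wait Done"
    "M Count Wait = N Count Wait" "M Count Count = N Count Count" "M Count Done = N Count Done"
    "M Done Wait = N Done Wait" "M Done Count = N Done Count" "M Done Done = N Done Done"
  shows "M = N"
proof (intro ext)
  show "M r s = N r s" for r s
    by (cases r; cases s) (simp_all add: assms)
qed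

lemma gadget_cases:
  "gadget j k =
     (if j < k then counting (if j = 0 then Om1 else Om0)
      else if j = k then exiting (if j = 0 then Om1 else Om0) else saturated)"
  by (rule kind_omat_eqI) (auto simp: gadget_def gadget_wt_def saturated_def)

lemma mprod_kind:
  "mprod UNIV M N i j = max (M i Wait + N Wait j) (max (M i Count + N Count j) (M i Done + N Done j))"
  by (simp add: mprod_def UNIV_kind max_def)

lemmas kind_mat_simps = mprod_kind mbar_def bar_offdiag_def saturated_def max_def less_eq_omega_def

lemma mpath_idem_blocks:
  "mpath_idem UNIV (counting Om1)" "mpath_idem UNIV (counting OmInf)"
  "mpath_idem UNIV (exiting Om1)" "mpath_idem UNIV (exiting OmInf)" "mpath_idem UNIV saturated"
  unfolding mpath_idem_def by (rule kind_omat_eqI; simp add: kind_mat_simps)+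

text \<open>The loop at \<open>Count\<close> in \<open>counting Om1\<close> stabilises to infinity,
  whereas \<open>exiting Om1\<close> has no diagonal entry above \<open>Om0\<close>.\<close>

lemma mstab_blocks:
  "mstab UNIV (counting Om1) = counting OmInf" "mstab UNIV (exiting Om1) = exiting Om1"
  unfolding mstab_def by (rule kind_omat_eqI; simp add: kind_mat_simps)+

text \<open>Flattening keeps an infinite value only if it is on the diagonal of the cube: so it is
  for \<open>counting OmInf\<close>, at \<open>Count\<close>, but not for
  \<open>exiting OmInf\<close>.\<close>

lemma mflat_blocks:
  "mflat UNIV (counting OmInf) = counting OmInf" "mflat UNIV (exiting OmInf) = exiting Om1"
  "mflat UNIV saturated = saturated"
  unfolding mflat_def by (rule kind_omat_eqI; simp add: kind_mat_simps)+

lemma mprod_blocks: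
  "mprod UNIV (counting OmInf) (counting Om0) = counting OmInf"
  "mprod UNIV (counting OmInf) (exiting Om0) = exiting OmInf"
  "mprod UNIV (exiting Om1) saturated = saturated"
  "mprod UNIV saturated saturated = saturated"
  by (rule kind_omat_eqI; simp add: kind_mat_simps)+

text \<open>The value of \<open>0\<close> stabilised, then multiplied by \<open>1\<close>, ...,
  \<open>h\<close> in turn with a flattening after each: gadgets up to \<open>h\<close> are finite
  again, larger ones are not.\<close>

definition tower :: "nat \<Rightarrow> nat \<Rightarrow> (nat, nat) elem" where
  "tower n h = Elem 0 OmInf 0
     (blk n (\<lambda>k. if h < k then counting OmInf else if h = k then exiting Om1 else saturated))"

section \<open>The tower as a nested expression and as a witness\<close>

lemma tower_0:
  "path_idem {..<3 * n} (letter n 0)" "tower n 0 = estab {..<3 * n} (letter n 0)"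
  by (auto simp: letter_def tower_def mpath_idem_blk mstab_blk gadget_cases mpath_idem_blocks
      mstab_blocks intro!: blk_cong)

text \<open>The letter \<open>Suc h\<close> saturates the gadgets up to \<open>h\<close>, moves the
  infinite entries of gadget \<open>Suc h\<close> off the diagonal, where flattening bars them, and
  leaves the larger gadgets as they are.\<close>

lemma tower_Suc:
  "path_idem {..<3 * n} (eprod {..<3 * n} (tower n h) (letter n (Suc h)))"
  "tower n (Suc h) = eflat {..<3 * n} (eprod {..<3 * n} (tower n h) (letter n (Suc h)))"
proof -
  have "eprod {..<3 * n} (tower n h) (letter n (Suc h)) = Elem 0 OmInf 0
     (blk n (\<lambda>k. if Suc h < k then counting OmInf else if Suc h = k then exiting OmInf else saturated))"
    by (auto simp: letter_def tower_def mprod_blk gadget_cases mprod_blocks intro!: blk_cong)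
  then show "path_idem {..<3 * n} (eprod {..<3 * n} (tower n h) (letter n (Suc h)))"
    "tower n (Suc h) = eflat {..<3 * n} (eprod {..<3 * n} (tower n h) (letter n (Suc h)))"
    by (auto simp: tower_def mpath_idem_blk mflat_blk mpath_idem_blocks mflat_blocks intro!: blk_cong)
qed

lemma letter_in_bar_semigroup: "j < n \<Longrightarrow> letter n j \<in> bar_semigroup (aut_A n) (aut_B n)"
  by (simp add: gens_aut bar_semigroup.gen)

lemma nested_tower: "h < n \<Longrightarrow> nested (aut_A n) (aut_B n) (Suc h) (tower n h)"
proof (induction h)
  case 0
  then show ?case
    using nested.innermost[of "letter n 0" "aut_A n" "aut_B n"]
    by (simp add: bar_monoid_def letter_in_bar_semigroup tower_0)
next
  case (Suc h)
  have "nested (aut_A n) (aut_B n) (Suc h) (tower n h)"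
    using Suc by simp
  from nested.step[OF this, of None "Some (letter n (Suc h))"] Suc.prems show ?case
    by (simp add: bar_monoid_def letter_in_bar_semigroup tower_Suc)
qed

lemma tower_expr:
  "h < n \<Longrightarrow> \<exists>s. set_sf_expr s \<subseteq> gens (aut_A n) (aut_B n) \<and>
     sf_eval {..<3 * n} s = tower n h \<and> expr_height s = Suc h"
proof (induction h)
  case 0
  then show ?case
    by (intro exI[of _ "Sharp (Leaf (letter n 0))"]) (simp add: tower_0 gens_aut)
next
  case (Suc h)
  then obtain s where "set_sf_expr s \<subseteq> gens (aut_A n) (aut_B n)"
    "sf_eval {..<3 * n} s = tower n h" "expr_height s = Suc h"
    by auto
  with Suc.prems show ?case
    by (intro exI[of _ "Flat (Prod s (Leaf (letter n (Suc h))))"]) (simp add: tower_Suc gens_aut)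
qed

lemma path_idem_not_Bot: "path_idem Q z \<Longrightarrow> z \<noteq> Bot"
  by auto

text \<open>\<open>Bot\<close> is excluded because the evaluation also returns it for a
  stabilisation or flattening that is not allowed.\<close>

lemma sf_eval_in_sf_semigroup:
  "set_sf_expr s \<subseteq> gens A B \<Longrightarrow> sf_eval (states B) s \<noteq> Bot \<Longrightarrow> sf_eval (states B) s \<in> sf_semigroup A B"
proof (induction s)
  case (Prod s t)
  have "sf_eval (states B) s \<noteq> Bot" "sf_eval (states B) t \<noteq> Bot"
    using Prod.prems by (cases "sf_eval (states B) s"; cases "sf_eval (states B) t"; simp)+
  with Prod show ?case
    by (auto intro: sf_semigroup.prod)
qed (auto intro: sf_semigroup.intros dest: path_idem_not_Bot split: if_splits)

text \<open>At level \<open>n - 1\<close> no visible gadget has the form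
  \<open>counting OmInf\<close>, so all matrix entries are finite while the weight in the first
  automaton is infinite.\<close>

lemma witness_tower:
  assumes "1 \<le> n"
  shows "witness (aut_A n) (aut_B n) (tower n (n - 1))"
proof -
  define m where
    "m k = (if n - 1 < k then counting OmInf else if n - 1 = k then exiting Om1 else saturated)" for k
  have tower: "tower n (n - 1) = Elem 0 OmInf 0 (blk n m)"
    by (simp only: tower_def m_def[abs_def])
  have lt: "OmNegInf < OmInf" "Om0 < OmInf" "Om1 < OmInf"
    by (simp_all add: less_omega_def)
  have ex: "exiting Om1 i j < OmInf" for i j
    by (cases i; cases j) (simp_all add: lt)
  have "blk n m p q < OmInf" for p q
    using ex by (auto simp: blk_def m_def saturated_def lt)
  then have "mprod (states (aut_B n)) (mprod (states (aut_B n)) (\<lambda>u::unit. \<lambda>r. bar_nmax (init (aut_B n) r)) (blk n m))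
          (\<lambda>r. \<lambda>u::unit. bar_nmax (final (aut_B n) r)) () () < OmInf"
    by (intro mprod_less_OmInf) (simp_all add: aut_B_def lt)
  moreover have "tower n (n - 1) \<in> sf_semigroup (aut_A n) (aut_B n)"
  proof -
    obtain s where s: "set_sf_expr s \<subseteq> gens (aut_A n) (aut_B n)"
      "sf_eval (states (aut_B n)) s = tower n (n - 1)"
      using tower_expr[of "n - 1" n] assms by auto
    have "sf_eval (states (aut_B n)) s \<in> sf_semigroup (aut_A n) (aut_B n)"
      by (rule sf_eval_in_sf_semigroup[OF s(1)]) (simp only: s(2) tower, simp)
    then show ?thesis
      by (simp only: s(2))
  qed
  ultimately show ?thesis
    by (simp add: witness_def tower del: One_nat_def)
qed

lemma tractable_witness_tower:
  assumes "1 \<le> n"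
  shows "tractable_witness (aut_A n) (aut_B n) (tower n (n - 1))"
  unfolding tractable_witness_def
proof (intro conjI witness_tower assms exI bexI)
  show "n \<le> 3 * card (bar_semigroup (aut_A n) (aut_B n))"
    using card_bar_semigroup[of n] by simp
  show "nested (aut_A n) (aut_B n) n (tower n (n - 1))"
    using nested_tower[of "n - 1" n] assms by simp
  show "Some (tower n (n - 1)) = eprod1 (states (aut_B n)) (eprod1 (states (aut_B n)) None (Some (tower n (n - 1)))) None"
    by simp
qed (simp_all add: bar_monoid_def)


section \<open>No witness of smaller height\<close>

lemma mprod_OmInf_left:
  fixes M N :: "kind omat"
  assumes "M i t = OmInf" "Om0 \<le> N t j"
  shows "mprod UNIV M N i j = OmInf"
  using mprod_ge[of UNIV t OmInf M i Om0 N j] assms by simp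

lemma mprod_OmInf_right:
  fixes M N :: "kind omat"
  assumes "Om0 \<le> M i t" "N t j = OmInf"
  shows "mprod UNIV M N i j = OmInf"
  using mprod_ge[of UNIV t Om0 M i OmInf N j] assms by simp

text \<open>A path from \<open>i\<close> to \<open>j\<close> can use the loop at \<open>t\<close>,
  whose weight of at least 1 becomes infinite.\<close>

lemma mstab_OmInf:
  fixes M :: "kind omat"
  assumes "Om1 \<le> M t t" "Om0 \<le> M i t" "Om0 \<le> M t j"
  shows "mstab UNIV M i j = OmInf"
  unfolding mstab_def
proof (rule mprod_OmInf_left)
  have "stab (M t t) = OmInf"
    using assms(1) by (cases "M t t") (simp_all add: less_eq_omega_def)
  then show "mprod UNIV M (\<lambda>p q. if p = q then stab (M p q) else M p q) i t = OmInf"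
    using assms(2) by (intro mprod_OmInf_right[of _ _ t]) simp_all
qed (fact assms)

lemma Om0_le_bar: "Om0 \<le> x \<Longrightarrow> Om0 \<le> bar x"
  using bar_mono[of Om0 x] by simp

text \<open>The diagonal of the cube is not barred, and the barred outer factors still connect
  \<open>i\<close> and \<open>j\<close> to \<open>t\<close>.\<close>

lemma mflat_OmInf:
  fixes M :: "kind omat"
  assumes "mprod UNIV (mprod UNIV M M) M t t = OmInf" "Om0 \<le> M i t" "Om0 \<le> M t j"
  shows "mflat UNIV M i j = OmInf"
  unfolding mflat_def
  using assms Om0_le_bar
  by (intro mprod_OmInf_left[of _ _ t] mprod_OmInf_right[of _ _ t])
    (simp_all add: bar_offdiag_def mbar_def)

text \<open>Entries of gadget \<open>k\<close> that a product involving exactly the letters in \<open>L\<close> cannot avoid.\<close>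

definition gadget_lower :: "nat \<Rightarrow> nat set \<Rightarrow> kind omat \<Rightarrow> bool" where
  "gadget_lower k L M \<longleftrightarrow>
     Om0 \<le> M Wait Wait \<and> Om0 \<le> M Done Done \<and>
     (k \<notin> L \<longrightarrow> (if 0 \<in> L then Om1 else Om0) \<le> M Count Count) \<and>
     (k \<in> L \<longrightarrow> Om0 \<le> M Count Done) \<and>
     (Suc k \<in> L \<longrightarrow> Om0 \<le> M Done Wait) \<and>
     (k = 0 \<and> 0 \<in> L \<longrightarrow> Om1 \<le> M Wait Done)"

text \<open>Starting in \<open>Wait\<close> is at least as good as starting in \<open>Count\<close>.
  The condition concerns rows only, so a product inherits it from its left factor.\<close>

definition row_dom :: "kind omat \<Rightarrow> bool" where
  "row_dom M \<longleftrightarrow> (\<forall>j. M Count j \<le> M Wait j)"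

lemma Om1_le_imp: "Om1 \<le> x \<Longrightarrow> Om0 \<le> x"
  by (cases x) (simp_all add: less_eq_omega_def)

lemma gadget_lower_gadget: "gadget_lower k {j} (gadget j k)"
  by (auto simp: gadget_lower_def gadget_cases saturated_def less_eq_omega_def)

lemma row_dom_gadget: "row_dom (gadget j k)"
proof -
  have "gadget j k Count s \<le> gadget j k Wait s" for s
    by (cases s) (simp_all add: gadget_cases saturated_def less_eq_omega_def)
  then show ?thesis
    by (simp add: row_dom_def)
qed

lemma gadget_lower_mono:
  assumes "gadget_lower k L M" "\<And>i j. M i j \<le> N i j"
  shows "gadget_lower k L N"
  using assms unfolding gadget_lower_def by (meson order_trans)

lemma gadget_lower_mbar: "gadget_lower k L M \<Longrightarrow> gadget_lower k L (mbar M)"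
  using bar_mono[of Om1] Om0_le_bar by (auto simp: gadget_lower_def mbar_def)

text \<open>Each bound has a path: from \<open>Count\<close> to \<open>Done\<close>, stay in
  \<open>Count\<close> until a factor contains \<open>k\<close> and then in \<open>Done\<close>;
  from \<open>Done\<close> to \<open>Wait\<close>, switch in a factor containing
  \<open>Suc k\<close>.\<close>

lemma gadget_lower_mprod:
  assumes M: "gadget_lower k L M" and N: "gadget_lower k L' N"
  shows "gadget_lower k (L \<union> L') (mprod UNIV M N)"
proof -
  have ge: "x \<le> M i t \<Longrightarrow> y \<le> N t j \<Longrightarrow> x + y \<le> mprod UNIV M N i j" for i t j x y
    by (rule mprod_ge) simp_all
  note M = M[unfolded gadget_lower_def] and N = N[unfolded gadget_lower_def]
  have "Om0 \<le> mprod UNIV M N Wait Wait"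
    using ge[of Om0 Wait Wait Om0 Wait] M N by simp
  moreover have "Om0 \<le> mprod UNIV M N Done Done"
    using ge[of Om0 Done Done Om0 Done] M N by simp
  moreover have "(if 0 \<in> L \<union> L' then Om1 else Om0) \<le> mprod UNIV M N Count Count" if "k \<notin> L \<union> L'"
    using ge[of "if 0 \<in> L then Om1 else Om0" Count Count "if 0 \<in> L' then Om1 else Om0" Count] M N that
    by (auto split: if_splits)
  moreover have "Om0 \<le> mprod UNIV M N Count Done" if "k \<in> L \<union> L'"
  proof (cases "k \<in> L")
    case True
    then show ?thesis
      using ge[of Om0 Count Done Om0 Done] M N by simp
  next
    case False
    then have "Om0 \<le> M Count Count"
      using M Om1_le_imp by (metis (full_types))
    then show ?thesis
      using ge[of Om0 Count Count Om0 Done] N that False by simp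
  qed
  moreover have "Om0 \<le> mprod UNIV M N Done Wait" if "Suc k \<in> L \<union> L'"
    using ge[of Om0 Done Wait Om0 Wait] ge[of Om0 Done Done Om0 Wait] M N that by auto
  moreover have "Om1 \<le> mprod UNIV M N Wait Done" if "k = 0" "0 \<in> L \<union> L'"
    using ge[of Om1 Wait Done Om0 Done] ge[of Om0 Wait Wait Om1 Done] M N that by auto
  ultimately show ?thesis
    unfolding gadget_lower_def by blast
qed

lemma gadget_lower_mstab:
  assumes "gadget_lower k L M"
  shows "gadget_lower k L (mstab UNIV M)"
proof -
  have "gadget_lower k L (\<lambda>p q. if p = q then stab (M p q) else M p q)"
    using assms by (rule gadget_lower_mono) (simp add: le_stab)
  then show ?thesis
    using assms gadget_lower_mprod[of k L _ L] by (simp add: mstab_def)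
qed

lemma bar_le: "bar x \<le> x"
  by (cases x) (simp_all add: less_eq_omega_def)

text \<open>All required bounds are at most \<open>Om1\<close>, hence survive barring.\<close>

lemma gadget_lower_mflat:
  assumes "gadget_lower k L M"
  shows "gadget_lower k L (mflat UNIV M)"
proof -
  have prod: "gadget_lower k L N \<Longrightarrow> gadget_lower k L N' \<Longrightarrow> gadget_lower k L (mprod UNIV N N')" for N N'
    using gadget_lower_mprod[of k L N L N'] by simp
  have "gadget_lower k L (mbar (mprod UNIV (mprod UNIV M M) M))"
    by (intro gadget_lower_mbar prod assms)
  then have "gadget_lower k L (bar_offdiag (mprod UNIV (mprod UNIV M M) M))"
    by (rule gadget_lower_mono) (simp add: mbar_def bar_offdiag_def bar_le)
  then show ?thesis
    unfolding mflat_def by (intro prod gadget_lower_mbar assms)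
qed

lemma row_dom_mprod:
  assumes "row_dom M"
  shows "row_dom (mprod UNIV M N)"
  unfolding row_dom_def
proof
  fix j
  have "M Count t + N t j \<le> mprod UNIV M N Wait j" for t
    using assms by (intro mprod_ge[of UNIV t]) (simp_all add: row_dom_def)
  then show "mprod UNIV M N Count j \<le> mprod UNIV M N Wait j"
    by (simp add: mprod_le_iff)
qed

lemma row_dom_mstab: "row_dom M \<Longrightarrow> row_dom (mstab UNIV M)"
  by (simp add: mstab_def row_dom_mprod)

lemma row_dom_mflat: "row_dom M \<Longrightarrow> row_dom (mflat UNIV M)"
  unfolding mflat_def by (intro row_dom_mprod) (simp add: row_dom_def mbar_def bar_mono)

text \<open>Without the letter \<open>k\<close> an infinite count stays on the diagonal at
  \<open>Count\<close>. Once \<open>k\<close> occurs, it belongs to a run from \<open>Wait\<close>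
  whose block is still open or already closed; these off-diagonal entries are the ones that
  flattening may lower.\<close>

definition gadget_inf :: "nat \<Rightarrow> nat set \<Rightarrow> kind omat \<Rightarrow> bool" where
  "gadget_inf k L M \<longleftrightarrow>
     (if k \<in> L then M Wait Count = OmInf \<or> M Wait Done = OmInf else M Count Count = OmInf)"

lemma gadget_inf_mprod_left:
  assumes M: "gadget_lower k L M" "row_dom M" "gadget_inf k L M" and N: "gadget_lower k L' N"
  shows "gadget_inf k (L \<union> L') (mprod UNIV M N)"
proof -
  have N': "Om0 \<le> N Done Done" "k \<in> L' \<Longrightarrow> Om0 \<le> N Count Done" "k \<notin> L' \<Longrightarrow> Om0 \<le> N Count Count"
    using N Om1_le_imp by (auto simp: gadget_lower_def split: if_splits)
  \<comment> \<open>Relevant when \<open>k\<close> occurs in \<open>N\<close> but not in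
    \<open>M\<close>: the infinite entry is then required in the row of \<open>Wait\<close>, not of
    \<open>Count\<close>.\<close>
  have "M Count Count \<le> M Wait Count"
    using M by (simp add: row_dom_def)
  then have "M Count Count = OmInf \<Longrightarrow> M Wait Count = OmInf"
    by simp
  then show ?thesis
    using M(3) N' mprod_OmInf_left[of M Wait Done N Done] mprod_OmInf_left[of M Wait Count N Done]
      mprod_OmInf_left[of M Wait Count N Count] mprod_OmInf_left[of M Count Count N Count]
    by (auto simp: gadget_inf_def split: if_splits)
qed

text \<open>The run stays in \<open>Wait\<close> during \<open>M\<close>, or in \<open>Count\<close>
  if \<open>k\<close> occurs in neither factor.\<close>

lemma gadget_inf_mprod_right:
  assumes M: "gadget_lower k L M" and N: "gadget_lower k L' N" "row_dom N" "gadget_inf k L' N"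
  shows "gadget_inf k (L \<union> L') (mprod UNIV M N)"
proof -
  have M': "Om0 \<le> M Wait Wait" "k \<notin> L \<Longrightarrow> Om0 \<le> M Count Count"
    using M Om1_le_imp by (auto simp: gadget_lower_def split: if_splits)
  have "N Count Count \<le> N Wait Count"
    using N by (simp add: row_dom_def)
  then have "N Count Count = OmInf \<Longrightarrow> N Wait Count = OmInf"
    by simp
  then show ?thesis
    using N(3) M' mprod_OmInf_right[of M Wait Wait N Done] mprod_OmInf_right[of M Wait Wait N Count]
      mprod_OmInf_right[of M Count Count N Count]
    by (auto simp: gadget_inf_def split: if_splits)
qed

lemma gadget_inf_mflat:
  assumes M: "gadget_lower k L M" "gadget_inf k L M" and "k \<notin> L"
  shows "gadget_inf k L (mflat UNIV M)"
proof -
  have "Om0 \<le> M Count Count" "M Count Count = OmInf"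
    using assms Om1_le_imp by (auto simp: gadget_lower_def gadget_inf_def split: if_splits)
  then show ?thesis
    using \<open>k \<notin> L\<close> by (simp add: gadget_inf_def mflat_OmInf[of _ Count] mprod_OmInf_left[of _ _ Count])
qed

text \<open>With \<open>k\<close> and \<open>Suc k\<close> both present, the cube contains a closed
  walk from \<open>Wait\<close> to \<open>Done\<close> and back that uses an infinite entry, so
  infinity lands on the diagonal.\<close>

lemma mflat_Wait_OmInf:
  assumes M: "gadget_lower k L M" "gadget_inf k L M" and "k \<in> L" "Suc k \<in> L"
  shows "mflat UNIV M Wait Wait = OmInf"
proof (rule mflat_OmInf)
  have lower: "Om0 \<le> M Wait Wait" "Om0 \<le> M Count Done" "Om0 \<le> M Done Done" "Om0 \<le> M Done Wait"
    using assms by (auto simp: gadget_lower_def)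
  consider "M Wait Count = OmInf" | "M Wait Done = OmInf"
    using assms by (auto simp: gadget_inf_def)
  then have "mprod UNIV M M Wait Done = OmInf"
    using lower by cases (auto intro: mprod_OmInf_left)
  then show "mprod UNIV (mprod UNIV M M) M Wait Wait = OmInf"
    using lower by (auto intro: mprod_OmInf_left)
  show "Om0 \<le> M Wait Wait" "Om0 \<le> M Wait Wait"
    using lower by simp_all
qed

text \<open>The first alternative is permanent, and flattening leaves the second one unchanged or turns it
  into the first one. Only the third alternative can be improved, by one gadget per flattening.\<close>

definition infinite_gadgets :: "nat \<Rightarrow> nat \<Rightarrow> nat set \<Rightarrow> (nat \<Rightarrow> kind omat) \<Rightarrow> bool" where
  "infinite_gadgets n h L m \<longleftrightarrow>
     (\<exists>k < n. m k Wait Wait = OmInf) \<or>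
     (\<exists>k. Suc k \<in> L \<and> gadget_inf k L (m k)) \<or>
     (\<forall>k \<ge> h. gadget_inf k L (m k))"

text \<open>\<open>L\<close> stands for the set of letters of an expression and \<open>h\<close> for
  a bound on its height; \<open>h\<close> matters only through the number of gadgets that may have
  become finite.\<close>

definition height_invariant :: "nat \<Rightarrow> nat \<Rightarrow> nat set \<Rightarrow> omega \<Rightarrow> (nat \<Rightarrow> kind omat) \<Rightarrow> bool" where
  "height_invariant n h L x m \<longleftrightarrow>
     L \<subseteq> {..<n} \<and> (Om0 < x \<longrightarrow> 0 \<in> L) \<and>
     (\<forall>k. gadget_lower k L (m k) \<and> row_dom (m k)) \<and>
     (x = OmInf \<longrightarrow> infinite_gadgets n h L m)"

section \<open>The height invariant under the operations of expressions\<close>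

lemma height_invariant_letter:
  "j < n \<Longrightarrow> height_invariant n 0 {j} (if j = 0 then Om1 else Om0) (gadget j)"
  by (simp add: height_invariant_def gadget_lower_gadget row_dom_gadget less_omega_def)

lemma Om0_less_plus: "Om0 < x + y \<Longrightarrow> Om0 < x \<or> Om0 < (y :: omega)"
  by (cases x; cases y) (simp_all add: less_omega_def)

text \<open>An infinite sum has an infinite summand, and each alternative that holds for this factor
  persists; the third one only weakens when \<open>h\<close> grows to the maximum.\<close>

lemma height_invariant_mprod:
  assumes m: "height_invariant n h L x m" and m': "height_invariant n h' L' x' m'"
  shows "height_invariant n (max h h') (L \<union> L') (x + x') (\<lambda>k. mprod UNIV (m k) (m' k))"
proof -
  have lower: "gadget_lower k L (m k)" "row_dom (m k)" "gadget_lower k L' (m' k)" "row_dom (m' k)" for k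
    using m m' by (auto simp: height_invariant_def)
  have "infinite_gadgets n (max h h') (L \<union> L') (\<lambda>k. mprod UNIV (m k) (m' k))" if inf: "x + x' = OmInf"
  proof -
    consider "infinite_gadgets n h L m" | "infinite_gadgets n h' L' m'"
      using omega_plus_eq_OmInf[OF inf] m m' unfolding height_invariant_def by blast
    then show ?thesis
    proof cases
      case 1
      moreover have "m k Wait Wait = OmInf \<Longrightarrow> mprod UNIV (m k) (m' k) Wait Wait = OmInf" for k
        using lower(3)[of k] by (auto simp: gadget_lower_def intro: mprod_OmInf_left)
      ultimately show ?thesis
        using gadget_inf_mprod_left[OF lower(1,2) _ lower(3)]
        unfolding infinite_gadgets_def by (meson UnI1 max.boundedE)
    next
      case 2
      moreover have "m' k Wait Wait = OmInf \<Longrightarrow> mprod UNIV (m k) (m' k) Wait Wait = OmInf" for k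
        using lower(1)[of k] by (auto simp: gadget_lower_def intro: mprod_OmInf_right)
      ultimately show ?thesis
        using gadget_inf_mprod_right[OF lower(1,3,4)]
        unfolding infinite_gadgets_def by (meson UnI2 max.boundedE)
    qed
  qed
  moreover have "Om0 < x + x' \<Longrightarrow> 0 \<in> L \<union> L'"
    using Om0_less_plus[of x x'] m m' by (auto simp: height_invariant_def)
  moreover have "L \<union> L' \<subseteq> {..<n}"
    using m m' by (auto simp: height_invariant_def)
  ultimately show ?thesis
    using lower by (simp add: height_invariant_def gadget_lower_mprod row_dom_mprod)
qed

lemma height_invariant_mstab:
  assumes m: "height_invariant n h L x m" and idem: "\<And>k. k < n \<Longrightarrow> mpath_idem UNIV (m k)"
  shows "height_invariant n (Suc h) L (stab x) (\<lambda>k. mstab UNIV (m k))"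
proof -
  have lower: "gadget_lower k L (m k)" "row_dom (m k)" for k
    using m by (auto simp: height_invariant_def)
  have L: "L \<subseteq> {..<n}" "Om0 < x \<Longrightarrow> 0 \<in> L"
    using m by (auto simp: height_invariant_def)
  have inf: "infinite_gadgets n (Suc h) L (\<lambda>k. mstab UNIV (m k))" if "0 \<in> L"
  proof (cases "1 \<in> L")
    case True
    have "Om1 \<le> m 0 Wait Done" "Om0 \<le> m 0 Done Wait" "Om0 \<le> m 0 Wait Wait"
      using lower(1)[of 0] that True by (auto simp: gadget_lower_def)
    then have "Om1 \<le> mbar (m 0) Wait Done" "Om0 \<le> mbar (m 0) Done Wait"
      using bar_mono[of Om1] bar_mono[of Om0] by (auto simp: mbar_def)
    \<comment> \<open>The round trip from \<open>Wait\<close> to \<open>Done\<close> and back has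
      weight at least 1. Path-idempotence puts this weight on the diagonal, where stabilisation
      makes it infinite.\<close>
    then have "Om1 + Om0 \<le> mprod UNIV (mbar (m 0)) (mbar (m 0)) Wait Wait"
      by (rule mprod_ge[rotated 2]) simp_all
    also have "\<dots> = mbar (m 0) Wait Wait"
      using idem[of 0] L that by (auto simp: mpath_idem_def)
    also have "\<dots> \<le> m 0 Wait Wait"
      by (simp add: mbar_def bar_le)
    finally have "Om1 \<le> m 0 Wait Wait"
      by simp
    with \<open>Om0 \<le> m 0 Wait Wait\<close> have "mstab UNIV (m 0) Wait Wait = OmInf"
      by (intro mstab_OmInf)
    then show ?thesis
      using L that by (auto simp: infinite_gadgets_def)
  next
    case False
    have inf: "gadget_inf k L (mstab UNIV (m k))" if "k \<notin> L" for k
      using lower(1)[of k] \<open>0 \<in> L\<close> that Om1_le_imp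
      by (auto simp: gadget_lower_def gadget_inf_def intro: mstab_OmInf)
    show ?thesis
    proof (cases "\<exists>k. Suc k \<in> L \<and> k \<notin> L")
      case True
      then show ?thesis
        using inf by (auto simp: infinite_gadgets_def)
    next
      case no_step: False
      \<comment> \<open>As 1 is absent and no \<open>Suc k\<close> occurs without \<open>k\<close>,
        only 0 occurs; hence the loop at \<open>Count\<close> becomes infinite in every gadget
        \<open>k > 0\<close>.\<close>
      have "Suc k \<notin> L" for k
        by (induction k) (use False no_step in auto)
      then have "k \<notin> L" if "k \<ge> Suc h" for k
        using that by (cases k) auto
      then show ?thesis
        using inf by (auto simp: infinite_gadgets_def)
    qed
  qed
  have "Om0 < stab x \<Longrightarrow> Om0 < x"
    by (cases x) (simp_all add: less_omega_def)
  moreover have "stab x = OmInf \<Longrightarrow> Om0 < stab x"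
    by (simp add: less_omega_def)
  ultimately show ?thesis
    using lower L inf by (auto simp: height_invariant_def gadget_lower_mstab row_dom_mstab)
qed

lemma height_invariant_mflat:
  assumes m: "height_invariant n h L x m"
  shows "height_invariant n (Suc h) L x (\<lambda>k. mflat UNIV (m k))"
proof -
  have lower: "gadget_lower k L (m k)" "row_dom (m k)" for k
    using m by (auto simp: height_invariant_def)
  have L: "L \<subseteq> {..<n}" "Om0 < x \<Longrightarrow> 0 \<in> L"
    using m by (auto simp: height_invariant_def)
  \<comment> \<open>Here an infinite gadget \<open>k\<close> together with the letter
    \<open>Suc k\<close> cannot be repaired: if \<open>k\<close> occurs, infinity moves to
    \<open>Wait\<close>; otherwise it stays at \<open>Count\<close>.\<close>
  have semi: "infinite_gadgets n (Suc h) L (\<lambda>k. mflat UNIV (m k))"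
    if "Suc k \<in> L" "gadget_inf k L (m k)" for k
  proof (cases "k \<in> L")
    case True
    then have "mflat UNIV (m k) Wait Wait = OmInf"
      using that lower by (intro mflat_Wait_OmInf) auto
    then show ?thesis
      using True L by (auto simp: infinite_gadgets_def)
  next
    case False
    then have "gadget_inf k L (mflat UNIV (m k))"
      using that lower by (intro gadget_inf_mflat)
    then show ?thesis
      using that by (auto simp: infinite_gadgets_def)
  qed
  have "infinite_gadgets n (Suc h) L (\<lambda>k. mflat UNIV (m k))" if "x = OmInf"
  proof -
    have "infinite_gadgets n h L m"
      using m that by (simp add: height_invariant_def)
    then consider k where "k < n" "m k Wait Wait = OmInf"
      | k where "Suc k \<in> L" "gadget_inf k L (m k)"
      | "\<And>k. k \<ge> h \<Longrightarrow> gadget_inf k L (m k)"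
      unfolding infinite_gadgets_def by blast
    then show ?thesis
    proof cases
      case 1
      then have "mflat UNIV (m k) Wait Wait = OmInf"
        by (intro mflat_OmInf[of _ Wait] mprod_OmInf_left[of _ _ Wait]) simp_all
      then show ?thesis
        using 1 by (auto simp: infinite_gadgets_def)
    next
      case 2
      then show ?thesis
        by (rule semi)
    next
      case 3
      show ?thesis
      proof (cases "\<exists>k \<ge> h. Suc k \<in> L")
        case True
        then show ?thesis
          using 3 semi by blast
      next
        case False
        \<comment> \<open>No letter exceeds \<open>h\<close>, so gadgets beyond \<open>h\<close>
          keep their diagonal infinity; gadget \<open>h\<close> is the only one given up.\<close>
        have "gadget_inf k L (mflat UNIV (m k))" if "k \<ge> Suc h" for k
        proof -
          have "k \<notin> L"
            using False that by (cases k) auto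
          then show ?thesis
            using 3 that lower by (intro gadget_inf_mflat) auto
        qed
        then show ?thesis
          by (auto simp: infinite_gadgets_def)
      qed
    qed
  qed
  then show ?thesis
    using lower L by (auto simp: height_invariant_def gadget_lower_mflat row_dom_mflat)
qed

section \<open>From the invariant to the height of witnesses\<close>

lemma sf_eval_invariant:
  assumes "set_sf_expr s \<subseteq> gens (aut_A n) (aut_B n)" "sf_eval {..<3 * n} s \<noteq> Bot"
  shows "\<exists>L x m. sf_eval {..<3 * n} s = Elem 0 x 0 (blk n m) \<and> height_invariant n (expr_height s) L x m"
  using assms
proof (induction s)
  case (Leaf z)
  then obtain j where "j < n" "z = letter n j"
    by (auto simp: gens_aut)
  then show ?case
    using height_invariant_letter[of j n]
    by (intro exI[of _ "{j}"] exI[of _ "if j = 0 then Om1 else Om0"] exI[of _ "gadget j"])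
      (simp add: letter_def)
next
  case (Prod s t)
  have "sf_eval {..<3 * n} s \<noteq> Bot" "sf_eval {..<3 * n} t \<noteq> Bot"
    using Prod.prems by (cases "sf_eval {..<3 * n} s"; cases "sf_eval {..<3 * n} t"; simp)+
  then obtain L x m L' x' m' where
    "sf_eval {..<3 * n} s = Elem 0 x 0 (blk n m)" "height_invariant n (expr_height s) L x m"
    "sf_eval {..<3 * n} t = Elem 0 x' 0 (blk n m')" "height_invariant n (expr_height t) L' x' m'"
    using Prod by auto
  then show ?case
    using height_invariant_mprod[of n "expr_height s" L x m "expr_height t" L' x' m']
    by (auto simp: mprod_blk)
next
  case (Sharp s)
  then have idem: "path_idem {..<3 * n} (sf_eval {..<3 * n} s)"
    by (auto split: if_splits)
  then have "sf_eval {..<3 * n} s \<noteq> Bot"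
    by auto
  with Sharp obtain L x m where s: "sf_eval {..<3 * n} s = Elem 0 x 0 (blk n m)"
    and inv: "height_invariant n (expr_height s) L x m"
    by auto
  have "height_invariant n (Suc (expr_height s)) L (stab x) (\<lambda>k. mstab UNIV (m k))"
    using idem s by (intro height_invariant_mstab[OF inv]) (simp add: mpath_idem_blk)
  moreover have "sf_eval {..<3 * n} (Sharp s) = Elem 0 (stab x) 0 (blk n (\<lambda>k. mstab UNIV (m k)))"
    using idem s by (simp add: mstab_blk)
  ultimately show ?case
    by auto
next
  case (Flat s)
  then have idem: "path_idem {..<3 * n} (sf_eval {..<3 * n} s)"
    by (auto split: if_splits)
  then have "sf_eval {..<3 * n} s \<noteq> Bot"
    by auto
  with Flat obtain L x m where s: "sf_eval {..<3 * n} s = Elem 0 x 0 (blk n m)"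
    and inv: "height_invariant n (expr_height s) L x m"
    by auto
  have "sf_eval {..<3 * n} (Flat s) = Elem 0 x 0 (blk n (\<lambda>k. mflat UNIV (m k)))"
    using idem s by (simp add: mflat_blk)
  then show ?case
    using height_invariant_mflat[OF inv] by auto
qed

text \<open>Each alternative concerns a visible block: the second because \<open>Suc k < n\<close>,
  the third because \<open>h < n\<close> makes it apply to \<open>n - 1\<close>.\<close>

lemma infinite_gadgets_entry:
  assumes "infinite_gadgets n h L m" "h < n" "L \<subseteq> {..<n}"
  shows "\<exists>k < n. \<exists>i j. m k i j = OmInf"
proof -
  have entry: "gadget_inf k L (m k) \<Longrightarrow> \<exists>i j. m k i j = OmInf" for k
    by (auto simp: gadget_inf_def split: if_splits)
  consider k where "k < n" "m k Wait Wait = OmInf"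
    | k where "Suc k \<in> L" "gadget_inf k L (m k)"
    | "gadget_inf (n - 1) L (m (n - 1))"
    using assms by (fastforce simp: infinite_gadgets_def)
  then show ?thesis
  proof cases
    case 1
    then show ?thesis by blast
  next
    case 2
    then have "k < n"
      using assms(3) by auto
    then show ?thesis
      using 2 entry by blast
  next
    case 3
    have "n - 1 < n"
      using assms(2) by simp
    then show ?thesis
      using 3 entry by blast
  qed
qed

text \<open>Makes the set minimised in \<open>sf_height\<close> nonempty, so that the minimum is
  attained by an expression.\<close>

lemma sf_semigroup_expr:
  "z \<in> sf_semigroup A B \<Longrightarrow> \<exists>s. set_sf_expr s \<subseteq> gens A B \<and> sf_eval (states B) s = z"
proof (induction rule: sf_semigroup.induct)
  case (gen z)
  then show ?case
    by (intro exI[of _ "Leaf z"]) simp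
next
  case (prod y z)
  then obtain s t where "set_sf_expr s \<subseteq> gens A B" "sf_eval (states B) s = y"
    "set_sf_expr t \<subseteq> gens A B" "sf_eval (states B) t = z"
    by blast
  then show ?case
    by (intro exI[of _ "Prod s t"]) simp
next
  case (stab z)
  then obtain s where "set_sf_expr s \<subseteq> gens A B" "sf_eval (states B) s = z"
    by blast
  with stab show ?case
    by (intro exI[of _ "Sharp s"]) simp
next
  case (flat z)
  then obtain s where "set_sf_expr s \<subseteq> gens A B" "sf_eval (states B) s = z"
    by blast
  with flat show ?case
    by (intro exI[of _ "Flat s"]) simp
qed

text \<open>All states of the second automaton are initial and final with weight 0, so a single
  infinite matrix entry makes the product with both vectors infinite. An expression of height below
  \<open>n\<close> has such an entry.\<close>

lemma witness_height:
  assumes w: "witness (aut_A n) (aut_B n) z"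
  shows "n \<le> sf_height (aut_A n) (aut_B n) z"
proof (rule ccontr)
  assume less: "\<not> n \<le> sf_height (aut_A n) (aut_B n) z"
  let ?P = "\<lambda>h. \<exists>s. set_sf_expr s \<subseteq> gens (aut_A n) (aut_B n) \<and>
    sf_eval (states (aut_B n)) s = z \<and> expr_height s = h"
  obtain s0 where "set_sf_expr s0 \<subseteq> gens (aut_A n) (aut_B n)" "sf_eval (states (aut_B n)) s0 = z"
    using w sf_semigroup_expr unfolding witness_def by blast
  then have "?P (expr_height s0)"
    by blast
  then have "?P (sf_height (aut_A n) (aut_B n) z)"
    unfolding sf_height_def by (rule LeastI)
  then obtain s where s: "set_sf_expr s \<subseteq> gens (aut_A n) (aut_B n)"
    "sf_eval {..<3 * n} s = z" "expr_height s < n"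
    using less by auto
  moreover obtain p q M where z: "z = Elem p OmInf q M" and bounded:
    "mprod (states (aut_B n)) (mprod (states (aut_B n)) (\<lambda>u::unit. \<lambda>r. bar_nmax (init (aut_B n) r)) M)
          (\<lambda>r. \<lambda>u::unit. bar_nmax (final (aut_B n) r)) () () < OmInf"
    using w unfolding witness_def by blast
  ultimately obtain L m where M: "M = blk n m" and inv: "height_invariant n (expr_height s) L OmInf m"
    using sf_eval_invariant[of s n] by auto
  then obtain k i j where k: "k < n" "m k i j = OmInf"
    using infinite_gadgets_entry[of n "expr_height s" L m] s(3) unfolding height_invariant_def by auto
  let ?I = "\<lambda>u::unit. \<lambda>r. bar_nmax (init (aut_B n) r)" and ?F = "\<lambda>r. \<lambda>u::unit. bar_nmax (final (aut_B n) r)"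
  have "Om0 + OmInf \<le> mprod {..<3 * n} ?I M () (state k j)"
    by (rule mprod_ge[of _ "state k i"]) (use k in \<open>simp_all add: M aut_B_def\<close>)
  then have "mprod {..<3 * n} ?I M () (state k j) = OmInf"
    by simp
  then have "OmInf + Om0 \<le> mprod {..<3 * n} (mprod {..<3 * n} ?I M) ?F () ()"
    by (intro mprod_ge[of "{..<3 * n}" "state k j" OmInf "mprod {..<3 * n} ?I M" "()" Om0 ?F "()"])
      (use k in \<open>simp_all add: aut_B_def\<close>)
  with bounded show False
    by simp
qed

lemma sf_height_tower:
  assumes "1 \<le> n"
  shows "sf_height (aut_A n) (aut_B n) (tower n (n - 1)) = n"
proof (rule order_antisym)
  show "sf_height (aut_A n) (aut_B n) (tower n (n - 1)) \<le> n"
    unfolding sf_height_def using tower_expr[of "n - 1" n] assms by (intro Least_le) simp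
  show "n \<le> sf_height (aut_A n) (aut_B n) (tower n (n - 1))"
    using assms by (intro witness_height witness_tower)
qed

theorem theorem10p6:
  "\<exists>(A :: nat \<Rightarrow> (nat, nat) mpa) (B :: nat \<Rightarrow> (nat, nat) mpa).
     \<forall>n \<ge> 1.
       mp_automaton (A n) \<and> mp_automaton (B n) \<and> alphabet (A n) = alphabet (B n) \<and>
       deterministic (A n) \<and>
       (\<exists>z. tractable_witness (A n) (B n) z \<and> sf_height (A n) (B n) z = n) \<and>
       \<not> (\<exists>z. witness (A n) (B n) z \<and> sf_height (A n) (B n) z < n)"
proof (rule exI[of _ aut_A], rule exI[of _ aut_B], intro allI impI)
  fix n :: nat
  assume n: "1 \<le> n"
  have "\<exists>z. tractable_witness (aut_A n) (aut_B n) z \<and> sf_height (aut_A n) (aut_B n) z = n"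
    using tractable_witness_tower[OF n] sf_height_tower[OF n] by blast
  moreover have "\<not> (\<exists>z. witness (aut_A n) (aut_B n) z \<and> sf_height (aut_A n) (aut_B n) z < n)"
    using witness_height by (auto simp: not_less)
  ultimately show "mp_automaton (aut_A n) \<and> mp_automaton (aut_B n) \<and>
      alphabet (aut_A n) = alphabet (aut_B n) \<and> deterministic (aut_A n) \<and>
      (\<exists>z. tractable_witness (aut_A n) (aut_B n) z \<and> sf_height (aut_A n) (aut_B n) z = n) \<and>
      \<not> (\<exists>z. witness (aut_A n) (aut_B n) z \<and> sf_height (aut_A n) (aut_B n) z < n)"
    by (simp add: mp_automaton_aut_A mp_automaton_aut_B deterministic_aut_A)
qed

end
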